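(* Let $X$ be a separable metric space and let $S\subset C_s(\mathbb{R},X)$ be a shift-invariant set that satisfies the compactness axiom. Then, for all $x\in X$, the limit sets $\omega_S(x)$ and $\alpha_S(x)$ are closed in $X$ and weakly invariant with respect to $S$.
   Context: A partial map with open domain $\phi:\mathbb{R}\to X$ is a continuous map $\phi:\mathrm{dom}\,\phi\to X$ defined on an open set $\mathrm{dom}\,\phi\subset\mathbb{R}$; write $\mathrm{im}\,\phi=\phi(\mathrm{dom}\,\phi)$. The set $C_p(\mathbb{R},X)$ of all of these carries the compact-open topology with subbasis $W(K,V)=\{\phi : K\subset\mathrm{dom}\,\phi,\ \phi(K)\subset V\}$, $K\subset\mathbb{R}$ compact, $V\subset X$ open; equivalently, $\phi_n\to\phi$ iff for each compact $K\subset\mathrm{dom}\,\phi$ one has $K\subset\mathrm{dom}\,\phi_n$ for all large $n$ and $\sup_{t\in K}d(\phi_n(t),\phi(t))\to0$. A $\phi\in C_p(\mathbb{R},X)$ with nonempty connected domain is maximally defined if any $\psi\in C_p(\mathbb{R},X)$ with nonempty connected domain, $\mathrm{dom}\,\phi\subset\mathrm{dom}\,\psi$ and $\psi=\phi$ on $\mathrm{dom}\,\phi$ equals $\phi$. $C_s(\mathbb{R},X)$ is the subspace of maximally defined maps. Shift: $\sigma(t,\phi)(s)=\phi(s+t)$ for $s\in\mathrm{dom}\,\phi-t$; it is a continuous flow. A set $S\subset C_s(\mathbb{R},X)$ is shift-invariant if $\sigma(t,\phi)\in S$ for all $\phi\in S$, $t\in\mathbb{R}$. Compactness axiom for $S$: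 for every compact $W\subset\mathbb{R}\times X$, the set $\{(t,\phi)\in\mathbb{R}\times S : t\in\mathrm{dom}\,\phi,\ (t,\phi(t))\in W\}$ is compact. Limit sets: for $B\subset S$, $\omega(B)=\bigcap_{t>0}\overline{\bigcup_{s\ge t}\sigma(s,B)}$ and $\alpha(B)=\bigcap_{t<0}\overline{\bigcup_{s\le t}\sigma(s,B)}$, closures taken in $S$. Let $\pi(\phi)=\phi(0)$, a partial map defined when $0\in\mathrm{dom}\,\phi$; images under $\pi$ are images of the part of the set where $\pi$ is defined. For $x\in X$ let $S_x=\{\phi\in S : 0\in\mathrm{dom}\,\phi,\ \phi(0)=x\}$, and $\omega_S(x)=\pi(\omega(S_x))$, $\alpha_S(x)=\pi(\alpha(S_x))$. $A\subset X$ is weakly invariant (with respect to $S$) if for every $y\in A$ there is $\phi\in S$ with $\phi(0)=y$ and $\mathrm{im}\,\phi\subset A$. *)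

theory Defs
  imports "HOL-Analysis.Analysis"
begin

text \<open>
  A partial map from the reals to X is a value of type \<open>real \<rightharpoonup> 'a\<close>: \<open>\<phi> t = Some x\<close> means that
  t lies in the domain and that the value at t is x. Hence \<open>dom \<phi>\<close> is the domain, \<open>ran \<phi>\<close> the
  image, and equality of option-valued functions is equality of partial maps.
\<close>

definition C_p :: "(real \<rightharpoonup> 'a::metric_space) set" where
  "C_p = {\<phi>. open (dom \<phi>) \<and> continuous_on (dom \<phi>) (\<lambda>t. the (\<phi> t))}"

definition W_sub :: "real set \<Rightarrow> 'a::metric_space set \<Rightarrow> (real \<rightharpoonup> 'a) set" where
  "W_sub K V = {\<phi> \<in> C_p. K \<subseteq> dom \<phi> \<and> (\<lambda>t. the (\<phi> t)) ` K \<subseteq> V}"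

text \<open>This topology is not Hausdorff: the only neighbourhood of the empty map is \<open>C_p\<close>.\<close>

definition compact_open_top :: "(real \<rightharpoonup> 'a::metric_space) topology" where
  "compact_open_top = topology_generated_by {W_sub K V | K V. compact K \<and> open V}"

lemma topspace_compact_open_top [simp]: "topspace compact_open_top = C_p"
proof -
  have "W_sub {} UNIV = C_p"
    by (auto simp: W_sub_def)
  then have "C_p \<subseteq> \<Union> {W_sub K V | K V. compact K \<and> open V}"
    by (metis (mono_tags, lifting) Sup_upper compact_empty mem_Collect_eq open_UNIV)
  moreover have "\<Union> {W_sub K V | K V. compact K \<and> open V} \<subseteq> C_p"
    by (auto simp: W_sub_def)
  ultimately show ?thesis
    unfolding compact_open_top_def topology_generated_by_topspace by (rule subset_antisym[rotated])
qed

text \<open>The map order \<open>\<phi> \<subseteq>\<^sub>m \<psi>\<close> says that \<open>dom \<phi> \<subseteq> dom \<psi>\<close> and that both maps agree on \<open>dom \<phi>\<close>.\<close>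

definition maximally_defined :: "(real \<rightharpoonup> 'a::metric_space) \<Rightarrow> bool" where
  "maximally_defined \<phi> \<longleftrightarrow>
     \<phi> \<in> C_p \<and> dom \<phi> \<noteq> {} \<and> connected (dom \<phi>) \<and>
     (\<forall>\<psi>\<in>C_p. dom \<psi> \<noteq> {} \<and> connected (dom \<psi>) \<and> \<phi> \<subseteq>\<^sub>m \<psi> \<longrightarrow> \<psi> = \<phi>)"

definition C_s :: "(real \<rightharpoonup> 'a::metric_space) set" where
  "C_s = {\<phi>. maximally_defined \<phi>}"

text \<open>The domain of \<open>shift t \<phi>\<close> is \<open>dom \<phi> - t\<close>.\<close>

definition shift :: "real \<Rightarrow> (real \<rightharpoonup> 'a) \<Rightarrow> (real \<rightharpoonup> 'a)" where
  "shift t \<phi> = (\<lambda>s. \<phi> (s + t))"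

definition shift_invariant :: "(real \<rightharpoonup> 'a) set \<Rightarrow> bool" where
  "shift_invariant S \<longleftrightarrow> (\<forall>\<phi>\<in>S. \<forall>t. shift t \<phi> \<in> S)"

definition compactness_axiom :: "(real \<rightharpoonup> 'a::metric_space) set \<Rightarrow> bool" where
  "compactness_axiom S \<longleftrightarrow>
     (\<forall>W :: (real \<times> 'a) set. compact W \<longrightarrow>
        compactin (prod_topology euclideanreal (subtopology compact_open_top S))
          {(t, \<phi>). \<phi> \<in> S \<and> t \<in> dom \<phi> \<and> (t, the (\<phi> t)) \<in> W})"

definition omega_limit :: "(real \<rightharpoonup> 'a::metric_space) set \<Rightarrow> (real \<rightharpoonup> 'a) set \<Rightarrow> (real \<rightharpoonup> 'a) set" where
  "omega_limit S B =
     (\<Inter>t\<in>{0<..}. subtopology compact_open_top S closure_of (\<Union>s\<in>{t..}. shift s ` B))"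

definition alpha_limit :: "(real \<rightharpoonup> 'a::metric_space) set \<Rightarrow> (real \<rightharpoonup> 'a) set \<Rightarrow> (real \<rightharpoonup> 'a) set" where
  "alpha_limit S B =
     (\<Inter>t\<in>{..<0}. subtopology compact_open_top S closure_of (\<Union>s\<in>{..t}. shift s ` B))"

text \<open>Image under the partial map \<open>\<phi> \<mapsto> \<phi>(0)\<close>; members with 0 outside their domain contribute nothing.\<close>

definition proj0_image :: "(real \<rightharpoonup> 'a) set \<Rightarrow> 'a set" where
  "proj0_image A = {y. \<exists>\<phi>\<in>A. \<phi> 0 = Some y}"

definition maps_through :: "(real \<rightharpoonup> 'a) set \<Rightarrow> 'a \<Rightarrow> (real \<rightharpoonup> 'a) set" where
  "maps_through S x = {\<phi> \<in> S. \<phi> 0 = Some x}"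

definition omega_pt :: "(real \<rightharpoonup> 'a::metric_space) set \<Rightarrow> 'a \<Rightarrow> 'a set" where
  "omega_pt S x = proj0_image (omega_limit S (maps_through S x))"

definition alpha_pt :: "(real \<rightharpoonup> 'a::metric_space) set \<Rightarrow> 'a \<Rightarrow> 'a set" where
  "alpha_pt S x = proj0_image (alpha_limit S (maps_through S x))"

definition weakly_invariant :: "(real \<rightharpoonup> 'a) set \<Rightarrow> 'a set \<Rightarrow> bool" where
  "weakly_invariant S A \<longleftrightarrow> (\<forall>y\<in>A. \<exists>\<phi>\<in>S. \<phi> 0 = Some y \<and> ran \<phi> \<subseteq> A)"

end

theory Submission
  imports Defs
begin

text \<open>
  One argument serves both time directions. What matters about the rays \<open>{t..}\<close> with \<open>t > 0\<close>,
  and about the rays \<open>{..t}\<close> with \<open>t < 0\<close>, is that every translate of a ray contains another ray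
  of the same family. The limit set is therefore studied for any family \<open>F\<close> of sets of times with
  this property.

  Weak invariance: the shift is continuous and moves tails of the flow into tails, so the limit
  set in \<open>S\<close> is shift-invariant (\<open>shift_tail_limit\<close>). If \<open>\<phi>\<close> is in the limit set and \<open>s\<close> is in its
  domain, then \<open>\<phi>\<close> shifted by \<open>s\<close> is again in the limit set and takes the value \<open>\<phi>(s)\<close> at time 0,
  so the whole image of \<open>\<phi>\<close> lies in the projected limit set.

  Closedness: the compactness axiom for \<open>W = {0} \<times> C\<close> says that the maps in \<open>S\<close> whose value at 0
  lies in a compact set \<open>C\<close> form a compact set. Evaluation at 0 is continuous, so every closed
  subset of \<open>S\<close>, the limit set included, has a projection that meets \<open>C\<close> in a compact set
  (\<open>compact_proj0_image_Int\<close>). A subset of a metric space that meets every compact set in a compact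
  set is closed, because a convergent sequence together with its limit is compact.
\<close>

definition tail_limit ::
    "real set set \<Rightarrow> (real \<rightharpoonup> 'a::metric_space) set \<Rightarrow> (real \<rightharpoonup> 'a) set \<Rightarrow> (real \<rightharpoonup> 'a) set" where
  "tail_limit F S B =
     (\<Inter>T\<in>F. subtopology compact_open_top S closure_of (\<Union>s\<in>T. shift s ` B))"

lemma omega_limit_eq_tail_limit: "omega_limit S B = tail_limit (atLeast ` {0<..}) S B"
  by (simp add: omega_limit_def tail_limit_def)

lemma alpha_limit_eq_tail_limit: "alpha_limit S B = tail_limit (atMost ` {..<0}) S B"
  by (simp add: alpha_limit_def tail_limit_def)

lemma shift_shift: "shift s (shift t \<phi>) = shift (s + t) \<phi>"
  by (simp add: shift_def add.assoc)

text \<open>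
  A shifted map sends \<open>K\<close> into \<open>V\<close> exactly when the original map sends the translate \<open>K + r\<close> into
  \<open>V\<close>, so preimages of subbasic sets are subbasic.
\<close>

lemma continuous_map_shift:
  fixes S :: "(real \<rightharpoonup> 'a::metric_space) set"
  assumes "S \<subseteq> C_p" and inv: "shift_invariant S"
  shows "continuous_map (subtopology compact_open_top S) (subtopology compact_open_top S) (shift r)"
proof -
  let ?X = "subtopology compact_open_top S"
  have top: "topspace ?X = S"
    using assms by auto
  have shift_S: "shift r \<phi> \<in> S" if "\<phi> \<in> S" for \<phi>
    using inv that by (auto simp: shift_invariant_def)
  have "continuous_map ?X compact_open_top (shift r)"
    unfolding compact_open_top_def
  proof (rule continuous_on_generated_topo, fold compact_open_top_def)
    fix U :: "(real \<rightharpoonup> 'a) set"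
    assume "U \<in> {W_sub K V | K V. compact K \<and> open V}"
    then obtain K V where U: "U = W_sub K V" and "compact K" "open V"
      by blast
    let ?K = "(\<lambda>t. t + r) ` K"
    have "compact ?K"
      using \<open>compact K\<close> by (intro compact_continuous_image continuous_intros)
    then have "openin compact_open_top (W_sub ?K V)"
      using \<open>open V\<close> unfolding compact_open_top_def
      by (intro topology_generated_by_Basis) blast
    moreover have "shift r -` U \<inter> topspace ?X = W_sub ?K V \<inter> S"
    proof -
      have "shift r \<phi> \<in> W_sub K V \<longleftrightarrow> \<phi> \<in> W_sub ?K V" if "\<phi> \<in> S" for \<phi>
      proof -
        have "\<phi> \<in> C_p" "shift r \<phi> \<in> C_p"
          using that shift_S \<open>S \<subseteq> C_p\<close> by auto
        moreover have "K \<subseteq> dom (shift r \<phi>) \<longleftrightarrow> ?K \<subseteq> dom \<phi>"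
          by (auto simp: shift_def dom_def)
        moreover have "(\<lambda>t. the (shift r \<phi> t)) ` K = (\<lambda>t. the (\<phi> t)) ` ?K"
          by (simp add: image_image shift_def)
        ultimately show ?thesis
          unfolding W_sub_def by simp
      qed
      then show ?thesis
        unfolding top U by blast
    qed
    ultimately show "openin ?X (shift r -` U \<inter> topspace ?X)"
      by (auto simp: openin_subtopology)
  next
    have "shift r ` topspace ?X \<subseteq> topspace compact_open_top"
      unfolding top using shift_S \<open>S \<subseteq> C_p\<close> by auto
    then show "shift r ` topspace ?X \<subseteq> \<Union> {W_sub K V | K V. compact K \<and> open V}"
      by (simp only: compact_open_top_def topology_generated_by_topspace)
  qed
  then show ?thesis
    using shift_S top by (auto simp: continuous_map_in_subtopology)
qed

lemma continuous_map_eval: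
  fixes S :: "(real \<rightharpoonup> 'a::metric_space) set"
  assumes "S \<subseteq> C_p" "\<And>\<phi>. \<phi> \<in> S \<Longrightarrow> t \<in> dom \<phi>"
  shows "continuous_map (subtopology compact_open_top S) euclidean (\<lambda>\<phi>. the (\<phi> t))"
  unfolding continuous_map_def
proof (intro conjI allI impI)
  let ?X = "subtopology (compact_open_top :: (real \<rightharpoonup> 'a) topology) S"
  fix V :: "'a set"
  assume "openin euclidean V"
  then have "openin compact_open_top (W_sub {t} V)"
    unfolding compact_open_top_def
    by (intro topology_generated_by_Basis) (auto intro!: exI[of _ "{t}"])
  moreover have "{\<phi> \<in> topspace ?X. the (\<phi> t) \<in> V} = W_sub {t} V \<inter> S"
    using assms by (auto simp: W_sub_def)
  ultimately show "openin ?X {\<phi> \<in> topspace ?X. the (\<phi> t) \<in> V}"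
    by (auto simp: openin_subtopology)
qed simp

lemma closedin_tail_limit:
  assumes "F \<noteq> {}"
  shows "closedin (subtopology compact_open_top S) (tail_limit F S B)"
  using assms unfolding tail_limit_def by (intro closedin_Inter) auto

lemma tail_limit_subset:
  assumes "F \<noteq> {}"
  shows "tail_limit F S B \<subseteq> S"
  using closedin_subset[OF closedin_tail_limit[OF assms]] by auto

text \<open>
  Continuity carries the closure of a tail indexed by \<open>T'\<close> into the closure of the tail indexed by
  \<open>T' + r\<close>, and the latter is part of a prescribed tail as soon as \<open>T' + r \<subseteq> T\<close>.
\<close>

lemma shift_tail_limit:
  assumes "S \<subseteq> C_p" "shift_invariant S"
    and translate: "\<And>T r. T \<in> F \<Longrightarrow> \<exists>T'\<in>F. (\<lambda>s. r + s) ` T' \<subseteq> T"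
    and "\<phi> \<in> tail_limit F S B"
  shows "shift r \<phi> \<in> tail_limit F S B"
  unfolding tail_limit_def
proof
  let ?X = "subtopology compact_open_top S"
  fix T
  assume "T \<in> F"
  then obtain T' where "T' \<in> F" and T': "(\<lambda>s. r + s) ` T' \<subseteq> T"
    using translate by blast
  have "shift r \<phi> \<in> shift r ` (?X closure_of (\<Union>s\<in>T'. shift s ` B))"
    using assms(4) \<open>T' \<in> F\<close> by (auto simp: tail_limit_def)
  also have "\<dots> \<subseteq> ?X closure_of (shift r ` (\<Union>s\<in>T'. shift s ` B))"
    by (rule continuous_map_image_closure_subset[OF continuous_map_shift[OF assms(1,2)]])
  also have "\<dots> \<subseteq> ?X closure_of (\<Union>s\<in>T. shift s ` B)"
    using T' by (intro closure_of_mono) (fastforce simp: shift_shift)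
  finally show "shift r \<phi> \<in> ?X closure_of (\<Union>s\<in>T. shift s ` B)" .
qed

lemma weakly_invariant_proj0_image:
  assumes "L \<subseteq> S" and inv: "\<And>r \<phi>. \<phi> \<in> L \<Longrightarrow> shift r \<phi> \<in> L"
  shows "weakly_invariant S (proj0_image L)"
  unfolding weakly_invariant_def
proof
  fix y
  assume "y \<in> proj0_image L"
  then obtain \<phi> where "\<phi> \<in> L" "\<phi> 0 = Some y"
    by (auto simp: proj0_image_def)
  moreover have "ran \<phi> \<subseteq> proj0_image L"
  proof
    fix z
    assume "z \<in> ran \<phi>"
    then obtain s where "shift s \<phi> 0 = Some z"
      by (auto simp: ran_def shift_def)
    then show "z \<in> proj0_image L"
      using inv[OF \<open>\<phi> \<in> L\<close>] by (auto simp: proj0_image_def)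
  qed
  ultimately show "\<exists>\<phi>\<in>S. \<phi> 0 = Some y \<and> ran \<phi> \<subseteq> proj0_image L"
    using \<open>L \<subseteq> S\<close> by blast
qed

lemma compactin_maps_through_compact:
  assumes "compactness_axiom S" "compact C"
  shows "compactin (subtopology compact_open_top S) {\<phi> \<in> S. \<exists>x\<in>C. \<phi> 0 = Some x}"
proof -
  let ?X = "subtopology compact_open_top S"
  let ?K = "{(t, \<phi>). \<phi> \<in> S \<and> t \<in> dom \<phi> \<and> (t, the (\<phi> t)) \<in> {0::real} \<times> C}"
  have "compactin (prod_topology euclideanreal ?X) ?K"
    using assms(1) compact_Times[OF compact_sing assms(2)] unfolding compactness_axiom_def by blast
  then have "compactin ?X (snd ` ?K)"
    by (rule image_compactin[OF _ continuous_map_snd])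
  also have "snd ` ?K = {\<phi> \<in> S. \<exists>x\<in>C. \<phi> 0 = Some x}"
    by (force simp: image_iff)
  finally show ?thesis .
qed

lemma compact_proj0_image_Int:
  fixes S :: "(real \<rightharpoonup> 'a::metric_space) set"
  assumes "S \<subseteq> C_p" "compactness_axiom S" "compact C"
    and closed: "closedin (subtopology compact_open_top S) L"
  shows "compact (proj0_image L \<inter> C)"
proof -
  let ?X = "subtopology (compact_open_top :: (real \<rightharpoonup> 'a) topology) S"
  let ?D = "{\<phi> \<in> S. 0 \<in> dom \<phi>}"
  let ?K = "L \<inter> {\<phi> \<in> S. \<exists>x\<in>C. \<phi> 0 = Some x}"
  have "L \<subseteq> S"
    using closedin_subset[OF closed] by auto
  have "compactin ?X ?K"
    using closed_Int_compactin[OF closed compactin_maps_through_compact] assms by blast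
  \<comment> \<open>Evaluation at 0 is continuous only where it is defined, so \<open>?K\<close> is viewed as a subset of \<open>?D\<close>.\<close>
  then have "compactin (subtopology compact_open_top ?D) ?K"
    by (auto simp: compactin_subtopology)
  moreover have "continuous_map (subtopology compact_open_top ?D) euclidean (\<lambda>\<phi>. the (\<phi> 0) :: 'a)"
    using \<open>S \<subseteq> C_p\<close> by (intro continuous_map_eval) auto
  ultimately have "compactin euclidean ((\<lambda>\<phi>. the (\<phi> 0)) ` ?K)"
    by (rule image_compactin)
  also have "(\<lambda>\<phi>. the (\<phi> 0)) ` ?K = proj0_image L \<inter> C"
    using \<open>L \<subseteq> S\<close> by (force simp: proj0_image_def)
  finally show ?thesis
    by simp
qed

text \<open>
  Membership of the limit of a sequence in \<open>A\<close> is decided inside the compact set that consists of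
  the sequence and its limit.
\<close>

lemma closed_if_compact_Int_compact:
  fixes A :: "'a::metric_space set"
  assumes "\<And>C. compact C \<Longrightarrow> compact (A \<inter> C)"
  shows "closed A"
  unfolding closed_sequential_limits
proof (intro allI impI, elim conjE)
  fix x l
  assume x: "\<forall>n. x n \<in> A" and lim: "x \<longlonglongrightarrow> l"
  have "compact (insert l (range x))"
    using compactin_sequence_with_limit[of euclidean x l "range x"] lim by simp
  then have "closed (A \<inter> insert l (range x))"
    by (intro compact_imp_closed assms)
  then have "l \<in> A \<inter> insert l (range x)"
    by (rule closed_sequentially[OF _ _ lim]) (use x in simp)
  then show "l \<in> A"
    by blast
qed

lemma closed_weakly_invariant_tail_limit:
  fixes S :: "(real \<rightharpoonup> 'a::metric_space) set"
  assumes "S \<subseteq> C_p" "shift_invariant S" "compactness_axiom S" "F \<noteq> {}"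
    and translate: "\<And>T r. T \<in> F \<Longrightarrow> \<exists>T'\<in>F. (\<lambda>s. r + s) ` T' \<subseteq> T"
  shows "closed (proj0_image (tail_limit F S B))"
    and "weakly_invariant S (proj0_image (tail_limit F S B))"
proof -
  show "closed (proj0_image (tail_limit F S B))"
    using compact_proj0_image_Int[OF assms(1,3) _ closedin_tail_limit[OF assms(4)]]
    by (rule closed_if_compact_Int_compact)
  show "weakly_invariant S (proj0_image (tail_limit F S B))"
    using tail_limit_subset[OF assms(4)] shift_tail_limit[OF assms(1,2) translate]
    by (rule weakly_invariant_proj0_image)
qed

theorem theoremB:
  fixes S :: "(real \<rightharpoonup> 'a::metric_space) set"
  assumes "separable_space (euclidean :: 'a topology)"
    and "S \<subseteq> C_s"
    and "shift_invariant S"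
    and "compactness_axiom S"
  shows "\<forall>x. closed (omega_pt S x) \<and> weakly_invariant S (omega_pt S x) \<and>
             closed (alpha_pt S x) \<and> weakly_invariant S (alpha_pt S x)"
proof -
  have "S \<subseteq> C_p"
    using assms(2) by (auto simp: C_s_def maximally_defined_def)
  note limit = closed_weakly_invariant_tail_limit[OF this assms(3,4)]
  have "\<exists>T'\<in>atLeast ` {0<..}. (\<lambda>s. r + s) ` T' \<subseteq> T" if "T \<in> atLeast ` {0<..}" for T and r :: real
  proof -
    from that obtain t where "T = {t..}"
      by blast
    \<comment> \<open>The translate of a ray by \<open>-r\<close> may start at a nonpositive time, hence the maximum with 1.\<close>
    then have "(\<lambda>s. r + s) ` {max 1 (t - r)..} \<subseteq> T"
      by auto
    moreover have "{max 1 (t - r)..} \<in> atLeast ` {0<..}"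
      by (intro imageI) simp
    ultimately show ?thesis
      by blast
  qed
  note omega = limit[OF _ this]
  have "\<exists>T'\<in>atMost ` {..<0}. (\<lambda>s. r + s) ` T' \<subseteq> T" if "T \<in> atMost ` {..<0}" for T and r :: real
  proof -
    from that obtain t where "T = {..t}"
      by blast
    then have "(\<lambda>s. r + s) ` {..min (- 1) (t - r)} \<subseteq> T"
      by auto
    moreover have "{..min (- 1) (t - r)} \<in> atMost ` {..<0}"
      by (intro imageI) simp
    ultimately show ?thesis
      by blast
  qed
  note alpha = limit[OF _ this]
  show ?thesis
    by (simp add: omega_pt_def alpha_pt_def omega_limit_eq_tail_limit alpha_limit_eq_tail_limit
        omega alpha)
qed

end
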